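(* Let $A\subset\mathbb{Z}_+$ and $\alpha\in\mathbb{R}$. If $$\frac{1}{n}\sum_{j=1}^n \mathbf{1}_{A}(j)\longrightarrow\alpha \quad\text{as } n\to\infty,$$ then $A$ has URI-density $\alpha$.
   Context: $\mathbb{Z}_+$ denotes the set of positive integers, and $\mathbf{1}_A$ the indicator function of $A$. A URI-set is a random set $\mathbf{E}$ of positive integers such that each integer $n\ge1$ belongs to $\mathbf{E}$ with probability $1/n$, the events $(n\in\mathbf{E})$, $n\ge1$, being independent. Almost surely $\mathbf{E}$ is infinite, and its ordered elements are denoted $N_1=1<N_2<\cdots<N_k<\cdots$. A set $A\subset\mathbb{Z}_+$ has URI-density $\alpha$ if, almost surely, $\frac1n\sum_{k=1}^n\mathbf{1}_A(N_k)\to\alpha$ as $n\to\infty$. *)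

theory Defs
  imports "HOL-Probability.Probability"
begin

locale URI_set = prob_space M for M :: "'w measure" +
  fixes E :: "'w \<Rightarrow> nat set"
  assumes positive: "\<omega> \<in> space M \<Longrightarrow> E \<omega> \<subseteq> {1..}"
    and indep: "indep_events (\<lambda>n. {\<omega> \<in> space M. n \<in> E \<omega>}) {1..}"
    and prob_mem: "n \<ge> 1 \<Longrightarrow> prob {\<omega> \<in> space M. n \<in> E \<omega>} = 1 / real n"

text \<open>
  The k-th smallest element of a set, counted from 1, whereas \<^const>\<open>enumerate\<close> counts from 0.
  The value is meaningful for infinite sets only; a URI-set is almost surely infinite.
\<close>

definition ordered_element :: "nat set \<Rightarrow> nat \<Rightarrow> nat" where
  "ordered_element S k = enumerate S (k - 1)"

text \<open>
  The URI-density is defined with respect to a given URI-set \<^term>\<open>E\<close> on a given probability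
  space \<^term>\<open>M\<close>; as only the law of \<^term>\<open>E\<close> matters, the choice is immaterial.
\<close>

definition has_URI_density :: "'w measure \<Rightarrow> ('w \<Rightarrow> nat set) \<Rightarrow> nat set \<Rightarrow> real \<Rightarrow> bool" where
  "has_URI_density M E A \<alpha> \<longleftrightarrow>
     (AE \<omega> in M. (\<lambda>n. 1 / real n * (\<Sum>k=1..n. indicator A (ordered_element (E \<omega>) k)))
        \<longlonglongrightarrow> \<alpha>)"

text \<open>URI-sets exist.\<close>

lemma URI_set_exists:
  "\<exists>(M :: (nat \<Rightarrow> bool) measure) E. URI_set M E"
proof -
  define B where "B n = measure_pmf (bernoulli_pmf (1 / real n))" for n
  define M where "M = Pi\<^sub>M (UNIV :: nat set) B"
  interpret B: prob_space "B n" for n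
    unfolding B_def by (rule measure_pmf.prob_space_axioms)
  interpret P: product_prob_space B UNIV ..
  interpret prob_space M
    unfolding M_def by (rule P.prob_space_axioms)
  define E where "E w = {n. n \<ge> 1 \<and> w n}" for w :: "nat \<Rightarrow> bool"
  have sp: "space M = UNIV"
    by (auto simp: M_def B_def space_PiM)
  have evJ: "(\<Inter>n\<in>J. {w \<in> space M. n \<in> E w}) = prod_emb UNIV B J (Pi\<^sub>E J (\<lambda>_. {True}))"
    if "J \<subseteq> {1..}" "J \<noteq> {}" for J
  proof -
    have "restrict w J \<in> Pi\<^sub>E J (\<lambda>_. {True}) \<longleftrightarrow> (\<forall>n\<in>J. w n)" for w
      unfolding restrict_PiE_iff by auto
    moreover have "(\<Inter>n\<in>J. {w \<in> space M. n \<in> E w}) = {w. \<forall>n\<in>J. w n}"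
      using that by (auto simp: E_def sp)
    ultimately show ?thesis
      by (simp add: prod_emb_def B_def space_PiM vimage_def del: PiE_singleton)
  qed
  have ev: "{w \<in> space M. n \<in> E w} = prod_emb UNIV B {n} (Pi\<^sub>E {n} (\<lambda>_. {True}))" if "n \<ge> 1" for n
    using evJ[of "{n}"] that by simp
  have pJ: "prob (\<Inter>n\<in>J. {w \<in> space M. n \<in> E w}) = (\<Prod>n\<in>J. measure (B n) {True})"
    if "J \<subseteq> {1..}" "J \<noteq> {}" "finite J" for J
    unfolding evJ[OF that(1,2)] unfolding M_def
    by (subst P.measure_PiM_emb) (use that in \<open>auto simp: B_def\<close>)
  have p1: "prob {w \<in> space M. n \<in> E w} = measure (B n) {True}" if "n \<ge> 1" for n
    using pJ[of "{n}"] that by simp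
  have pb: "measure (B n) {True} = 1 / real n" if "n \<ge> 1" for n
    using that by (simp add: B_def measure_pmf_single)
  have sets: "{w \<in> space M. n \<in> E w} \<in> sets M" if "n \<ge> 1" for n
    unfolding ev[OF that] unfolding M_def by (rule sets_PiM_I) (auto simp: B_def)
  have "URI_set M E"
  proof
    show "E w \<subseteq> {1..}" for w by (auto simp: E_def)
    show "prob {w \<in> space M. n \<in> E w} = 1 / real n" if "n \<ge> 1" for n
      using p1 pb that by simp
    show "indep_events (\<lambda>n. {w \<in> space M. n \<in> E w}) {1..}"
    proof (rule indep_eventsI)
      show "{w \<in> space M. n \<in> E w} \<in> events" if "n \<in> {1..}" for n
        using sets that by simp
      show "prob (\<Inter>n\<in>J. {w \<in> space M. n \<in> E w}) = (\<Prod>n\<in>J. prob {w \<in> space M. n \<in> E w})"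
        if "J \<subseteq> {1..}" "finite J" "J \<noteq> {}" for J
        unfolding pJ[OF that(1,3,2)] using p1 that by (intro prod.cong) auto
    qed
  qed
  then show ?thesis by blast
qed

end

theory Submission
  imports Defs "HOL-Real_Asymp.Real_Asymp"
begin


text \<open>
  Write \<open>H n\<close> for the harmonic sum \<open>1 + 1/2 + ... + 1/n\<close>. The expected number of elements of
  the URI-set in \<open>A \<inter> {1..n}\<close> is the sum of \<open>1/j\<close> over \<open>j \<in> A \<inter> {1..n}\<close>. An ordinary density
  is also a logarithmic density (\<open>Cesaro_imp_logarithmic_mean\<close>), so this expectation divided by
  \<open>H n\<close> tends to \<open>\<alpha>\<close>.

  The actual number of elements follows its expectation with an error \<open>o(H n)\<close>, almost surely.
  This is a strong law for independent events (\<open>strong_law_indep_events\<close>): the variance of the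
  count is at most \<open>H n\<close>, hence along times at which \<open>H\<close> is about \<open>k\<^sup>2\<close> the squared normalised
  errors have a finite expected sum and the errors vanish; between two such times, counts and
  expectations are monotone and \<open>H\<close> grows only by \<open>O(k)\<close>, which is \<open>o(k\<^sup>2)\<close>.

  Using this both for \<open>A\<close> and for the set of all integers, the URI-set has
  \<open>(\<alpha> + o(1)) H n\<close> elements in \<open>A \<inter> {1..n}\<close> and \<open>(1 + o(1)) H n\<close> elements in \<open>{1..n}\<close>. The quotient
  of the two, read at the \<open>n\<close>-th element of the URI-set, is the mean in the definition of the
  URI-density (\<open>mean_along_ordered_elements_tendsto\<close>).
\<close>

section \<open>Means and logarithmic means\<close>

text \<open>
  The indices at which \<open>x i\<close> is far from the limit are finitely many, and their total weight is
  negligible because the weights have an infinite sum.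
\<close>

lemma weighted_Cesaro:
  fixes w x :: "nat \<Rightarrow> real"
  assumes w: "\<And>i. w i \<ge> 0"
    and W: "filterlim (\<lambda>n. \<Sum>i=1..n. w i) at_top sequentially"
    and x: "x \<longlonglongrightarrow> L"
  shows "(\<lambda>n. (\<Sum>i=1..n. w i * x i) / (\<Sum>i=1..n. w i)) \<longlonglongrightarrow> L"
proof (rule LIMSEQ_I)
  fix e :: real assume e: "e > 0"
  define W where "W n = (\<Sum>i=1..n. w i)" for n
  obtain m where m: "\<And>i. i \<ge> m \<Longrightarrow> \<bar>x i - L\<bar> < e / 2"
    using LIMSEQ_D[OF x, of "e / 2"] e by auto
  define C where "C = (\<Sum>i=1..m. w i * \<bar>x i - L\<bar>)"
  have C0: "C \<ge> 0" unfolding C_def by (intro sum_nonneg mult_nonneg_nonneg w) auto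
  have "eventually (\<lambda>n. W n \<ge> 2 * C / e + 1) sequentially"
    using W unfolding W_def filterlim_at_top by blast
  then obtain n0 where n0: "\<And>n. n \<ge> n0 \<Longrightarrow> W n \<ge> 2 * C / e + 1"
    unfolding eventually_sequentially by blast
  show "\<exists>no. \<forall>n\<ge>no. norm ((\<Sum>i=1..n. w i * x i) / (\<Sum>i=1..n. w i) - L) < e"
  proof (intro exI allI impI)
    fix n assume "n \<ge> max n0 m"
    then have W_ge: "W n \<ge> 2 * C / e + 1" and "n \<ge> m" using n0 by auto
    moreover have "2 * C / e \<ge> 0" using C0 e by simp
    ultimately have Wpos: "W n > 0" and "2 * C / e < W n" by linarith+
    then have CW: "C < e / 2 * W n" using e by (simp add: field_simps)
    have "\<bar>\<Sum>i=1..n. w i * (x i - L)\<bar> \<le> (\<Sum>i=1..n. w i * \<bar>x i - L\<bar>)"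
      by (rule order_trans[OF sum_abs]) (simp add: abs_mult w)
    also have "\<dots> \<le> (\<Sum>i=1..n. (if i \<le> m then w i * \<bar>x i - L\<bar> else 0) + e / 2 * w i)"
    proof (rule sum_mono)
      fix i
      show "w i * \<bar>x i - L\<bar> \<le> (if i \<le> m then w i * \<bar>x i - L\<bar> else 0) + e / 2 * w i"
        using mult_left_mono[OF less_imp_le[OF m[of i]] w[of i]] w[of i] e by (auto simp: mult.commute)
    qed
    also have "\<dots> = C + e / 2 * W n"
    proof -
      have "{1..n} \<inter> {i. i \<le> m} = {1..m}" using \<open>n \<ge> m\<close> by auto
      then show ?thesis
        by (simp add: sum.distrib C_def W_def sum_distrib_left sum.If_cases)
    qed
    also have "\<dots> < e * W n" using CW by simp
    finally have "\<bar>\<Sum>i=1..n. w i * (x i - L)\<bar> < e * W n" .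
    moreover have "(\<Sum>i=1..n. w i * x i) / W n - L = (\<Sum>i=1..n. w i * (x i - L)) / W n"
    proof -
      have "(\<Sum>i=1..n. w i * (x i - L)) = (\<Sum>i=1..n. w i * x i) - W n * L"
        by (simp add: W_def right_diff_distrib sum_subtractf sum_distrib_right)
      then show ?thesis using Wpos by (simp add: diff_divide_distrib)
    qed
    ultimately show "norm ((\<Sum>i=1..n. w i * x i) / (\<Sum>i=1..n. w i) - L) < e"
      using Wpos unfolding W_def[symmetric] by (simp add: abs_divide pos_divide_less_eq)
  qed
qed

lemma harmonic_sum_at_top: "filterlim (\<lambda>n. \<Sum>j=1..n. 1 / real j) at_top sequentially"
  using harm_at_top by (simp add: harm_def[abs_def] inverse_eq_divide)

text \<open>
  By summation by parts, the logarithmic mean is up to a negligible term a weighted mean of the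
  ordinary means, with weights \<open>1/j\<close>.
\<close>

lemma Cesaro_imp_logarithmic_mean:
  fixes a :: "nat \<Rightarrow> real"
  assumes "(\<lambda>n. 1 / real n * (\<Sum>j=1..n. a j)) \<longlonglongrightarrow> \<alpha>"
  shows "(\<lambda>n. (\<Sum>j=1..n. a j / real j) / (\<Sum>j=1..n. 1 / real j)) \<longlonglongrightarrow> \<alpha>"
proof -
  define c where "c n = 1 / real n * (\<Sum>j=1..n. a j)" for n
  have c: "c \<longlonglongrightarrow> \<alpha>" using assms by (simp add: c_def[abs_def])
  have summation: "(\<Sum>j=1..n. a j / real j) = c n + (\<Sum>j=1..n. 1 / real j * c (j - 1))" for n
  proof (induction n)
    case 0
    show ?case by (simp add: c_def)
  next
    case (Suc n)
    have "a (Suc n) / real (Suc n) + c n = c (Suc n) + 1 / real (Suc n) * c n"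
    proof -
      have S: "(\<Sum>j=1..n. a j) = real n * c n" by (cases "n = 0") (simp_all add: c_def)
      have "c (Suc n) = (real n * c n + a (Suc n)) / real (Suc n)"
        unfolding S[symmetric] by (simp add: c_def)
      then show ?thesis by (simp add: field_simps)
    qed
    then show ?case using Suc by simp
  qed
  have "(\<lambda>j. c (j - 1)) \<longlonglongrightarrow> \<alpha>"
    using c by (subst filterlim_sequentially_Suc[symmetric]) simp
  from weighted_Cesaro[OF _ harmonic_sum_at_top this]
  have "(\<lambda>n. (\<Sum>j=1..n. 1 / real j * c (j - 1)) / (\<Sum>j=1..n. 1 / real j)) \<longlonglongrightarrow> \<alpha>"
    by simp
  from tendsto_add[OF tendsto_divide_0[OF c filterlim_at_top_imp_at_infinity[OF harmonic_sum_at_top]] this]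
  show ?thesis unfolding summation add_divide_distrib by simp
qed

section \<open>A strong law for independent events\<close>

text \<open>
  Independence makes the centred indicators pairwise orthogonal, so that their variances
  \<open>p (1 - p) \<le> p\<close> add up.
\<close>

lemma (in prob_space) second_moment_centred_count_le:
  assumes indep: "indep_events B I" and J: "finite J" "J \<subseteq> I"
  shows "expectation (\<lambda>\<omega>. (\<Sum>i\<in>J. indicator (B i) \<omega> - prob (B i))\<^sup>2) \<le> (\<Sum>i\<in>J. prob (B i))"
proof -
  have ev [measurable]: "B i \<in> events" if "i \<in> J" for i
    using indep J that by (auto simp: indep_events_def)
  have int: "integrable M (\<lambda>\<omega>. indicator S \<omega> :: real)" if "S \<in> events" for S
    using that by (simp add: less_top[symmetric])
  have moment: "expectation (\<lambda>\<omega>. (indicator (B i) \<omega> - prob (B i)) * (indicator (B j) \<omega> - prob (B j)))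
      = prob (B i \<inter> B j) - prob (B i) * prob (B j)"
    and int_prod: "integrable M (\<lambda>\<omega>. (indicator (B i) \<omega> - prob (B i)) * (indicator (B j) \<omega> - prob (B j)))"
    if "i \<in> J" "j \<in> J" for i j
  proof -
    have eq: "(indicator (B i) \<omega> - prob (B i)) * (indicator (B j) \<omega> - prob (B j))
       = indicator (B i \<inter> B j) \<omega> - prob (B j) * indicator (B i) \<omega> - prob (B i) * indicator (B j) \<omega>
         + prob (B i) * prob (B j)" for \<omega>
      by (simp add: indicator_inter_arith algebra_simps)
    have [simp]: "B i \<in> events" "B j \<in> events" "B i \<inter> B j \<in> events" using ev that by auto
    show "integrable M (\<lambda>\<omega>. (indicator (B i) \<omega> - prob (B i)) * (indicator (B j) \<omega> - prob (B j)))"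
      unfolding eq by (intro Bochner_Integration.integrable_add Bochner_Integration.integrable_diff
          integrable_mult_right int) auto
    show "expectation (\<lambda>\<omega>. (indicator (B i) \<omega> - prob (B i)) * (indicator (B j) \<omega> - prob (B j)))
      = prob (B i \<inter> B j) - prob (B i) * prob (B j)"
      unfolding eq by (simp add: int prob_space less_top[symmetric])
  qed
  have diag: "prob (B i \<inter> B j) - prob (B i) * prob (B j) \<le> (if i = j then prob (B i) else 0)"
    if "i \<in> J" "j \<in> J" for i j
  proof (cases "i = j")
    case True
    have "prob (B j) * prob (B j) \<ge> 0" by simp
    then show ?thesis unfolding True by simp
  next
    case False
    have "{i, j} \<subseteq> I" using J that by auto
    with indep have "prob (\<Inter>k\<in>{i, j}. B k) = (\<Prod>k\<in>{i, j}. prob (B k))"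
      unfolding indep_events_def by (metis finite.emptyI finite_insert insert_not_empty)
    then show ?thesis using False by simp
  qed
  have "expectation (\<lambda>\<omega>. (\<Sum>i\<in>J. indicator (B i) \<omega> - prob (B i))\<^sup>2)
      = (\<Sum>i\<in>J. \<Sum>j\<in>J. prob (B i \<inter> B j) - prob (B i) * prob (B j))"
    unfolding power2_eq_square sum_product
    by (subst Bochner_Integration.integral_sum, intro Bochner_Integration.integrable_sum int_prod,
        assumption, assumption, intro sum.cong refl,
        subst Bochner_Integration.integral_sum, intro int_prod, assumption, assumption,
        intro sum.cong refl moment)
  also have "\<dots> \<le> (\<Sum>i\<in>J. \<Sum>j\<in>J. if i = j then prob (B i) else 0)"
    by (intro sum_mono diag)
  also have "\<dots> = (\<Sum>i\<in>J. prob (B i))" using J by simp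
  finally show ?thesis .
qed

text \<open>
  The series of squares has a finite integral, by monotone convergence. So it converges almost
  everywhere, and its terms tend to 0.
\<close>

lemma AE_tendsto_0_if_summable_second_moments:
  fixes Y :: "nat \<Rightarrow> 'a \<Rightarrow> real"
  assumes [measurable]: "\<And>k. Y k \<in> borel_measurable M"
    and int: "\<And>k. integrable M (\<lambda>\<omega>. (Y k \<omega>)\<^sup>2)"
    and sum: "summable (\<lambda>k. \<integral>\<omega>. (Y k \<omega>)\<^sup>2 \<partial>M)"
  shows "AE \<omega> in M. (\<lambda>k. Y k \<omega>) \<longlonglongrightarrow> 0"
proof -
  have "(\<integral>\<^sup>+ \<omega>. (\<Sum>k. ennreal ((Y k \<omega>)\<^sup>2)) \<partial>M) = (\<Sum>k. ennreal (\<integral>\<omega>. (Y k \<omega>)\<^sup>2 \<partial>M))"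
    by (subst nn_integral_suminf) (auto simp: nn_integral_eq_integral int)
  also have "\<dots> = ennreal (\<Sum>k. \<integral>\<omega>. (Y k \<omega>)\<^sup>2 \<partial>M)"
    by (rule suminf_ennreal2[OF _ sum]) simp
  finally have "(\<integral>\<^sup>+ \<omega>. (\<Sum>k. ennreal ((Y k \<omega>)\<^sup>2)) \<partial>M) \<noteq> \<infinity>" by simp
  then have "AE \<omega> in M. (\<Sum>k. ennreal ((Y k \<omega>)\<^sup>2)) \<noteq> \<infinity>"
    by (intro nn_integral_PInf_AE) auto
  then show ?thesis
  proof eventually_elim
    case (elim \<omega>)
    then have "summable (\<lambda>k. (Y k \<omega>)\<^sup>2)"
      by (intro summable_suminf_not_top) (auto simp: top_ennreal_def infinity_ennreal_def)
    then have "(\<lambda>k. (Y k \<omega>)\<^sup>2) \<longlonglongrightarrow> 0" by (rule summable_LIMSEQ_zero)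
    from tendsto_real_sqrt[OF this] show ?case by (simp add: tendsto_rabs_zero_iff)
  qed
qed

text \<open>
  The deterministic half of the strong law, for a count \<open>T\<close> with expectation \<open>m\<close> and a normaliser \<open>s\<close>
  whose increments dominate those of \<open>m\<close>. The index \<open>u k\<close> is the first one at which \<open>s\<close> reaches
  \<open>k\<^sup>2\<close>. For \<open>u k \<le> n \<le> u (k + 1)\<close>, monotonicity bounds the deviation \<open>\<bar>T n - m n\<bar>\<close> by the
  deviations at the two ends plus the growth of \<open>m\<close> in between, which is of order \<open>k\<close>, whereas
  \<open>s n \<ge> k\<^sup>2\<close>.
\<close>

lemma tendsto_0_by_monotone_interpolation:
  fixes T m s :: "nat \<Rightarrow> real"
  assumes T: "mono T" and m: "mono m" and sm: "mono (\<lambda>n. s n - m n)"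
    and s: "s 0 \<ge> 0" "filterlim s at_top sequentially"
    and u_less: "\<And>k n. n < u k \<Longrightarrow> s n < (real k)\<^sup>2"
    and u_bounds: "\<And>k. (real k)\<^sup>2 \<le> s (u k)" "\<And>k. s (u k) \<le> (real k)\<^sup>2 + 1"
    and Y: "(\<lambda>k. (T (u k) - m (u k)) / (real (Suc k))\<^sup>2) \<longlonglongrightarrow> 0"
  shows "(\<lambda>n. (T n - m n) / s n) \<longlonglongrightarrow> 0"
proof -
  define y where "y k = \<bar>(T (u k) - m (u k)) / (real (Suc k))\<^sup>2\<bar>" for k
  have y: "y \<longlonglongrightarrow> 0" unfolding y_def by (intro tendsto_rabs_zero Y)
  \<comment> \<open>\<open>\<kappa> n\<close> is the index of the interval containing \<open>n\<close>, and \<open>b\<close> bounds the normalised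
    deviation on that interval.\<close>
  define b where "b k = y k * ((real k + 1)\<^sup>2 / (real k)\<^sup>2) + y (Suc k) * ((real k + 2)\<^sup>2 / (real k)\<^sup>2)
    + (2 * real k + 2) / (real k)\<^sup>2" for k
  define \<kappa> where "\<kappa> n = nat \<lfloor>sqrt (s n)\<rfloor>" for n
  have "b \<longlonglongrightarrow> 0 * 1 + 0 * 1 + 0"
    unfolding b_def
    by (intro tendsto_add tendsto_mult y LIMSEQ_Suc[OF y]) real_asymp+
  then have b: "b \<longlonglongrightarrow> 0" by simp
  have mono_s: "mono s"
    using m sm unfolding mono_def by (smt (verit, best))
  have lim\<kappa>: "filterlim \<kappa> sequentially sequentially"
    unfolding \<kappa>_def
    by (rule filterlim_compose[OF filterlim_nat_sequentially],
        rule filterlim_compose[OF filterlim_floor_sequentially],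
        rule filterlim_compose[OF sqrt_at_top s(2)])
  have bound: "\<bar>(T n - m n) / s n\<bar> \<le> b (\<kappa> n)" if k1: "\<kappa> n \<ge> 1" for n
  proof -
    define k where "k = \<kappa> n"
    have sn: "s n \<ge> 0" using s(1) monoD[OF mono_s, of 0 n] by simp
    have "real k \<le> sqrt (s n)" "sqrt (s n) < real k + 1"
      unfolding k_def \<kappa>_def using sn by (auto simp: of_nat_nat)
    then have low: "(real k)\<^sup>2 \<le> s n" and high: "s n < (real (Suc k))\<^sup>2"
      using real_le_rsqrt sn
      by (metis of_nat_0_le_iff power_mono real_sqrt_pow2)
         (metis \<open>sqrt (s n) < real k + 1\<close> of_nat_Suc add.commute real_sqrt_ge_zero sn power_strict_mono real_sqrt_pow2 zero_less_numeral)
    have "u k \<le> n" using u_less low by (meson not_le)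
    have "n \<le> u (Suc k)" using u_bounds(1)[of "Suc k"] high monoD[OF mono_s, of "u (Suc k)" n] by linarith
    have gap: "m (u (Suc k)) - m (u k) \<le> 2 * real k + 2"
    proof -
      have "s (u k) - m (u k) \<le> s (u (Suc k)) - m (u (Suc k))"
        using monoD[OF sm] \<open>u k \<le> n\<close> \<open>n \<le> u (Suc k)\<close> by force
      then show ?thesis
        using u_bounds(1)[of k] u_bounds(2)[of "Suc k"] by (simp add: power2_eq_square algebra_simps)
    qed
    have D: "\<bar>T (u j) - m (u j)\<bar> = y j * (real j + 1)\<^sup>2" for j
      by (simp add: y_def abs_divide add.commute)
    have "\<bar>T n - m n\<bar> \<le> y k * (real k + 1)\<^sup>2 + y (Suc k) * (real k + 2)\<^sup>2 + (2 * real k + 2)"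
      using D[of k] D[of "Suc k"] gap monoD[OF T \<open>u k \<le> n\<close>] monoD[OF T \<open>n \<le> u (Suc k)\<close>]
        monoD[OF m \<open>u k \<le> n\<close>] monoD[OF m \<open>n \<le> u (Suc k)\<close>]
      by (simp add: add.commute)
    also have "\<dots> = b k * (real k)\<^sup>2"
      using k1 by (simp add: b_def k_def field_simps)
    finally have le: "\<bar>T n - m n\<bar> \<le> b k * (real k)\<^sup>2" .
    have "b k \<ge> 0" by (auto simp: b_def y_def)
    then have "b k * (real k)\<^sup>2 \<le> b k * s n" using low by (rule mult_left_mono[rotated])
    moreover have "s n > 0" using low k1 by (smt (verit) k_def of_nat_0_less_iff zero_less_power less_le_trans zero_less_one)
    ultimately show ?thesis using le by (simp add: abs_divide pos_divide_le_eq k_def[symmetric])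
  qed
  have "eventually (\<lambda>n. \<kappa> n \<ge> 1) sequentially"
    using lim\<kappa> by (simp add: filterlim_at_top)
  then have "eventually (\<lambda>n. norm ((T n - m n) / s n) \<le> b (\<kappa> n)) sequentially"
    by eventually_elim (use bound in simp)
  then show ?thesis
    by (rule Lim_null_comparison) (rule filterlim_compose[OF b lim\<kappa>])
qed


text \<open>
  Only the events with index in \<open>A\<close> are counted, but the normaliser is the sum of all
  probabilities. This form covers the sets \<open>A\<close> for which the sum of the probabilities over \<open>A\<close> is
  finite, where counts and expectations are not asymptotically equivalent.
\<close>

lemma (in prob_space) strong_law_indep_events:
  fixes B :: "nat \<Rightarrow> 'a set" and A :: "nat set"
  assumes indep: "indep_events B {1..}"
    and lim: "filterlim (\<lambda>n. \<Sum>i=1..n. prob (B i)) at_top sequentially"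
  shows "AE \<omega> in M. (\<lambda>n. ((\<Sum>i\<in>A \<inter> {1..n}. indicator (B i) \<omega>) - (\<Sum>i\<in>A \<inter> {1..n}. prob (B i)))
           / (\<Sum>i=1..n. prob (B i))) \<longlonglongrightarrow> 0"
proof -
  define s where "s n = (\<Sum>i=1..n. prob (B i))" for n
  define m where "m n = (\<Sum>i\<in>A \<inter> {1..n}. prob (B i))" for n
  define T where "T \<omega> n = (\<Sum>i\<in>A \<inter> {1..n}. indicator (B i) \<omega> :: real)" for \<omega> n
  define u where "u k = (LEAST n. (real k)\<^sup>2 \<le> s n)" for k
  have s_lim: "filterlim s at_top sequentially" using lim by (simp add: s_def[abs_def])
  have ev [measurable]: "B i \<in> events" if "i \<ge> 1" for i
    using indep that by (auto simp: indep_events_def)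
  have u_ge: "(real k)\<^sup>2 \<le> s (u k)" for k
  proof -
    have "eventually (\<lambda>n. (real k)\<^sup>2 \<le> s n) sequentially"
      using s_lim by (simp add: filterlim_at_top)
    then have "\<exists>n. (real k)\<^sup>2 \<le> s n" by (auto simp: eventually_sequentially)
    then show ?thesis unfolding u_def by (rule LeastI_ex)
  qed
  have u_less: "s n < (real k)\<^sup>2" if "n < u k" for n k
    using not_less_Least[OF that[unfolded u_def]] by simp
  have u_le: "s (u k) \<le> (real k)\<^sup>2 + 1" for k
  proof (cases "u k")
    case 0
    then show ?thesis by (simp add: s_def)
  next
    case (Suc n)
    then have "s (u k) = s n + prob (B (Suc n))" by (simp add: s_def)
    then show ?thesis using u_less[of n k] Suc prob_le_1[of "B (Suc n)"] by linarith
  qed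
  have m_le: "m n \<le> s n" for n
    unfolding m_def s_def by (rule sum_mono2) auto
  have mono_m: "mono m" and mono_T: "mono (T \<omega>)" for \<omega>
    unfolding m_def T_def by (intro monoI sum_mono2; force)+
  have sm: "s n - m n = (\<Sum>i\<in>{1..n} - A. prob (B i))" for n
  proof -
    have "{1..n} = (A \<inter> {1..n}) \<union> ({1..n} - A)" by auto
    then have "s n = m n + (\<Sum>i\<in>{1..n} - A. prob (B i))"
      unfolding s_def m_def by (subst sum.union_disjoint[symmetric]) (auto intro: sum.cong)
    then show ?thesis by simp
  qed
  have mono_sm: "mono (\<lambda>n. s n - m n)"
    unfolding sm by (intro monoI sum_mono2) auto
  \<comment> \<open>Normalising by \<open>(k + 1)\<^sup>2\<close> instead of \<open>k\<^sup>2\<close> avoids a division by 0 and absorbs the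
    excess 1 in the bound \<open>k\<^sup>2 + 1\<close> for the variance.\<close>
  define Y where "Y k \<omega> = (T \<omega> (u k) - m (u k)) / (real (Suc k))\<^sup>2" for k \<omega>
  have T_meas [measurable]: "(\<lambda>\<omega>. T \<omega> n) \<in> borel_measurable M" for n
    unfolding T_def by (intro borel_measurable_sum borel_measurable_indicator ev) auto
  have Y_meas [measurable]: "Y k \<in> borel_measurable M" for k
    unfolding Y_def by measurable
  have moment: "expectation (\<lambda>\<omega>. (Y k \<omega>)\<^sup>2) \<le> inverse ((real (Suc k))\<^sup>2)" for k
  proof -
    have "expectation (\<lambda>\<omega>. (T \<omega> (u k) - m (u k))\<^sup>2) \<le> m (u k)"
      unfolding T_def m_def sum_subtractf[symmetric]
      by (rule second_moment_centred_count_le[OF indep]) auto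
    also have "\<dots> \<le> (real (Suc k))\<^sup>2"
      using m_le[of "u k"] u_le[of k] by (simp add: power2_eq_square algebra_simps)
    finally have "expectation (\<lambda>\<omega>. (T \<omega> (u k) - m (u k))\<^sup>2) \<le> (real (Suc k))\<^sup>2" .
    moreover define q where "q = (real (Suc k))\<^sup>2"
    ultimately have le: "expectation (\<lambda>\<omega>. (T \<omega> (u k) - m (u k))\<^sup>2) \<le> q" by simp
    have "q > 0" unfolding q_def by simp
    have "expectation (\<lambda>\<omega>. (Y k \<omega>)\<^sup>2) = expectation (\<lambda>\<omega>. (T \<omega> (u k) - m (u k))\<^sup>2) / q\<^sup>2"
      unfolding Y_def power_divide q_def by (rule integral_divide_zero)
    also have "\<dots> \<le> q / q\<^sup>2" using le by (rule divide_right_mono) simp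
    also have "\<dots> = inverse q" using \<open>q > 0\<close> by (simp add: power2_eq_square inverse_eq_divide)
    finally show ?thesis by (simp only: q_def)
  qed
  have Y_bound: "\<bar>Y k \<omega>\<bar> \<le> real (u k) + m (u k)" for k \<omega>
  proof -
    have "T \<omega> (u k) \<le> (\<Sum>i\<in>A \<inter> {1..u k}. 1)"
      unfolding T_def by (intro sum_mono) (auto simp: indicator_def)
    also have "\<dots> \<le> (\<Sum>i\<in>{1..u k}. 1)" by (intro sum_mono2) auto
    finally have "T \<omega> (u k) \<le> real (u k)" by simp
    moreover have "T \<omega> (u k) \<ge> 0" "m (u k) \<ge> 0" unfolding T_def m_def by (auto intro: sum_nonneg)
    ultimately have "\<bar>T \<omega> (u k) - m (u k)\<bar> \<le> real (u k) + m (u k)" by simp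
    moreover have "\<bar>Y k \<omega>\<bar> \<le> \<bar>T \<omega> (u k) - m (u k)\<bar> / 1"
      unfolding Y_def abs_divide by (rule divide_left_mono) auto
    ultimately show ?thesis by simp
  qed
  have Y_int: "integrable M (\<lambda>\<omega>. (Y k \<omega>)\<^sup>2)" for k
  proof (rule integrable_const_bound[where B = "(real (u k) + m (u k))\<^sup>2"])
    show "AE \<omega> in M. norm ((Y k \<omega>)\<^sup>2) \<le> (real (u k) + m (u k))\<^sup>2"
      unfolding real_norm_def abs_power2 by (intro AE_I2 abs_le_square_iff[THEN iffD1] order_trans[OF Y_bound abs_ge_self])
  qed measurable
  have "summable (\<lambda>k. expectation (\<lambda>\<omega>. (Y k \<omega>)\<^sup>2))"
  proof (rule summable_comparison_test')
    show "summable (\<lambda>k. inverse ((real (Suc k))\<^sup>2))"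
      using inverse_power_summable[of 2, where ?'a = real]
      by (subst summable_Suc_iff[of "\<lambda>k. inverse ((real k)\<^sup>2)"]) simp
    show "norm (expectation (\<lambda>\<omega>. (Y k \<omega>)\<^sup>2)) \<le> inverse ((real (Suc k))\<^sup>2)" if "k \<ge> 0" for k
      using moment[of k] by simp
  qed
  then have "AE \<omega> in M. (\<lambda>k. Y k \<omega>) \<longlonglongrightarrow> 0"
    by (intro AE_tendsto_0_if_summable_second_moments Y_meas Y_int)
  then show ?thesis
  proof eventually_elim
    case (elim \<omega>)
    have "s 0 \<ge> 0" by (simp add: s_def)
    from tendsto_0_by_monotone_interpolation[OF mono_T mono_m mono_sm this s_lim u_less u_ge u_le
        elim[unfolded Y_def]]
    show ?case by (simp add: T_def m_def s_def)
  qed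
qed

section \<open>Sums along the ordered elements of a set\<close>

lemma sum_ordered_element:
  fixes f :: "nat \<Rightarrow> real"
  assumes S: "infinite S" "S \<subseteq> {1..}" and n: "n \<ge> 1"
  shows "(\<Sum>k=1..n. f (ordered_element S k)) = (\<Sum>j\<in>S \<inter> {1..ordered_element S n}. f j)"
proof (rule sum.reindex_bij_betw)
  show "bij_betw (ordered_element S) {1..n} (S \<inter> {1..ordered_element S n})"
    unfolding bij_betw_def
  proof
    show "inj_on (ordered_element S) {1..n}"
    proof (rule inj_onI)
      fix i j assume "i \<in> {1..n}" "j \<in> {1..n}" "ordered_element S i = ordered_element S j"
      then show "i = j"
        using injD[OF inj_enumerate[OF S(1)], of "i - 1" "j - 1"] by (auto simp: ordered_element_def)
    qed
    show "ordered_element S ` {1..n} = S \<inter> {1..ordered_element S n}"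
    proof (intro equalityI subsetI)
      fix x assume "x \<in> ordered_element S ` {1..n}"
      then show "x \<in> S \<inter> {1..ordered_element S n}"
        using S enumerate_in_set[OF S(1)] by (fastforce simp: ordered_element_def)
    next
      fix x assume x: "x \<in> S \<inter> {1..ordered_element S n}"
      then obtain i where i: "enumerate S i = x" using enumerate_Ex[OF S(1)] by blast
      then have "i \<le> n - 1" using x S(1) by (auto simp: ordered_element_def)
      then have "Suc i \<in> {1..n}" using n by auto
      moreover have "ordered_element S (Suc i) = x" using i by (simp add: ordered_element_def)
      ultimately show "x \<in> ordered_element S ` {1..n}" by blast
    qed
  qed
qed

lemma filterlim_ordered_element:
  assumes "infinite S"
  shows "filterlim (ordered_element S) sequentially sequentially"
proof -
  have "filterlim (\<lambda>n. ordered_element S (Suc n)) sequentially sequentially"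
    using filterlim_subseq[OF strict_mono_enumerate[OF assms]] by (simp add: ordered_element_def)
  then show ?thesis by (subst (asm) filterlim_sequentially_Suc)
qed

text \<open>
  The count of elements of \<open>S\<close> in \<open>{1..n}\<close> is equivalent to \<open>H n\<close>, so it can replace \<open>H n\<close> as the
  normaliser; at the \<open>n\<close>-th element of \<open>S\<close> this count is \<open>n\<close>. The same hypothesis forces \<open>S\<close> to be
  infinite, which makes the enumeration meaningful.
\<close>

lemma mean_along_ordered_elements_tendsto:
  fixes H f :: "nat \<Rightarrow> real"
  assumes S: "S \<subseteq> {1..}" and H: "filterlim H at_top sequentially"
    and count: "(\<lambda>n. real (card (S \<inter> {1..n})) / H n) \<longlonglongrightarrow> 1"
    and sum: "(\<lambda>n. (\<Sum>j\<in>S \<inter> {1..n}. f j) / H n) \<longlonglongrightarrow> \<alpha>"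
  shows "(\<lambda>n. 1 / real n * (\<Sum>k=1..n. f (ordered_element S k))) \<longlonglongrightarrow> \<alpha>"
proof -
  have "infinite S"
  proof
    assume fin: "finite S"
    have "(\<lambda>n. real (card (S \<inter> {1..n})) / H n) \<longlonglongrightarrow> 0"
    proof (rule Lim_null_comparison)
      show "(\<lambda>n. real (card S) / H n) \<longlonglongrightarrow> 0"
        by (intro tendsto_divide_0[OF tendsto_const] filterlim_at_top_imp_at_infinity H)
      have "eventually (\<lambda>n. H n > 0) sequentially"
        using H by (simp add: filterlim_at_top_dense)
      then show "eventually (\<lambda>n. norm (real (card (S \<inter> {1..n})) / H n) \<le> real (card S) / H n) sequentially"
        by eventually_elim (use fin in \<open>auto intro!: divide_right_mono card_mono simp: abs_divide\<close>)
    qed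
    from LIMSEQ_unique[OF count this] show False by simp
  qed
  have "eventually (\<lambda>n. H n > 0) sequentially"
    using H by (simp add: filterlim_at_top_dense)
  then have "eventually (\<lambda>n. ((\<Sum>j\<in>S \<inter> {1..n}. f j) / H n) / (real (card (S \<inter> {1..n})) / H n)
      = (\<Sum>j\<in>S \<inter> {1..n}. f j) / real (card (S \<inter> {1..n}))) sequentially"
    by eventually_elim simp
  from Lim_transform_eventually[OF tendsto_divide[OF sum count] this]
  have "(\<lambda>n. (\<Sum>j\<in>S \<inter> {1..n}. f j) / real (card (S \<inter> {1..n}))) \<longlonglongrightarrow> \<alpha>" by simp
  from filterlim_compose[OF this filterlim_ordered_element[OF \<open>infinite S\<close>]]
  show ?thesis
  proof (rule Lim_transform_eventually)
    show "eventually (\<lambda>n. (\<Sum>j\<in>S \<inter> {1..ordered_element S n}. f j) / real (card (S \<inter> {1..ordered_element S n}))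
      = 1 / real n * (\<Sum>k=1..n. f (ordered_element S k))) sequentially"
      using eventually_ge_at_top[of 1]
    proof eventually_elim
      case (elim n)
      have "real (card (S \<inter> {1..ordered_element S n})) = real n"
        using sum_ordered_element[OF \<open>infinite S\<close> S elim, of "\<lambda>_. 1"] by simp
      then show ?case
        using sum_ordered_element[OF \<open>infinite S\<close> S elim, of f] by simp
    qed
  qed
qed

section \<open>Natural density implies URI-density\<close>

theorem theorem3p3:
  fixes M :: "'w measure" and E :: "'w \<Rightarrow> nat set" and A :: "nat set" and \<alpha> :: real
  assumes "URI_set M E"
    and "A \<subseteq> {1..}"
    and "(\<lambda>n. 1 / real n * (\<Sum>j=1..n. indicator A j)) \<longlonglongrightarrow> \<alpha>"
  shows "has_URI_density M E A \<alpha>"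
proof -
  interpret URI_set M E by fact
  define B where "B n = {\<omega> \<in> space M. n \<in> E \<omega>}" for n
  define H where "H n = (\<Sum>i=1..n. 1 / real i)" for n
  have prob_B: "prob (B i) = 1 / real i" if "i \<ge> 1" for i
    using prob_mem[OF that] by (simp add: B_def)
  have H: "(\<Sum>i=1..n. prob (B i)) = H n" for n
    unfolding H_def by (intro sum.cong) (auto simp: prob_B)
  have H_lim: "filterlim H at_top sequentially"
    unfolding H_def by (rule harmonic_sum_at_top)
  have indep_B: "indep_events B {1..}" using indep by (simp add: B_def[abs_def])
  \<comment> \<open>Stated for arbitrary \<open>C\<close>, because \<open>C = A\<close> gives the numerator and \<open>C = UNIV\<close> the
    denominator of the mean along the URI-set.\<close>
  have count_lim: "AE \<omega> in M. (\<lambda>n. (\<Sum>j\<in>E \<omega> \<inter> {1..n}. indicator C j :: real) / H n) \<longlonglongrightarrow> \<gamma>"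
    if C: "(\<lambda>n. 1 / real n * (\<Sum>j=1..n. indicator C j)) \<longlonglongrightarrow> \<gamma>" for C \<gamma>
  proof -
    have mean: "(\<Sum>i\<in>C \<inter> {1..n}. prob (B i)) = (\<Sum>j=1..n. indicator C j / real j)" for n
    proof -
      have "(\<Sum>i\<in>C \<inter> {1..n}. prob (B i)) = (\<Sum>i\<in>C \<inter> {1..n}. 1 / real i)"
        by (intro sum.cong) (auto simp: prob_B)
      also have "\<dots> = (\<Sum>j=1..n. indicator C j / real j)"
        by (intro sum.mono_neutral_cong_left) (auto simp: indicator_def)
      finally show ?thesis .
    qed
    have log: "(\<lambda>n. (\<Sum>i\<in>C \<inter> {1..n}. prob (B i)) / H n) \<longlonglongrightarrow> \<gamma>"
      unfolding mean H_def by (rule Cesaro_imp_logarithmic_mean[OF C])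
    have "AE \<omega> in M. (\<lambda>n. ((\<Sum>i\<in>C \<inter> {1..n}. indicator (B i) \<omega>) - (\<Sum>i\<in>C \<inter> {1..n}. prob (B i)))
           / H n) \<longlonglongrightarrow> 0"
      using strong_law_indep_events[OF indep_B, of C] H_lim unfolding H by simp
    then show ?thesis
    proof (rule AE_mp, intro AE_I2 impI)
      fix \<omega> assume \<omega>: "\<omega> \<in> space M"
        and lim: "(\<lambda>n. ((\<Sum>i\<in>C \<inter> {1..n}. indicator (B i) \<omega>) - (\<Sum>i\<in>C \<inter> {1..n}. prob (B i))) / H n) \<longlonglongrightarrow> 0"
      have "(\<Sum>i\<in>C \<inter> {1..n}. indicator (B i) \<omega> :: real) = (\<Sum>j\<in>E \<omega> \<inter> {1..n}. indicator C j)" for n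
      proof -
        have "(\<Sum>i\<in>C \<inter> {1..n}. indicator (B i) \<omega> :: real) = (\<Sum>i\<in>C \<inter> E \<omega> \<inter> {1..n}. 1)"
          using \<omega> by (intro sum.mono_neutral_cong_right) (auto simp: B_def indicator_def)
        also have "\<dots> = (\<Sum>j\<in>E \<omega> \<inter> {1..n}. indicator C j)"
          by (intro sum.mono_neutral_cong_left) (auto simp: indicator_def)
        finally show ?thesis .
      qed
      with tendsto_add[OF lim log]
      show "(\<lambda>n. (\<Sum>j\<in>E \<omega> \<inter> {1..n}. indicator C j :: real) / H n) \<longlonglongrightarrow> \<gamma>"
        by (simp add: diff_divide_distrib)
    qed
  qed
  have "(\<lambda>n. 1 / real n * (\<Sum>j=1..n. indicator UNIV j)) \<longlonglongrightarrow> (1::real)"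
    by (rule Lim_transform_eventually[OF tendsto_const])
       (use eventually_gt_at_top[of 0] in \<open>eventually_elim, simp\<close>)
  from count_lim[OF this] count_lim[OF assms(3)]
  have "AE \<omega> in M. (\<lambda>n. 1 / real n * (\<Sum>k=1..n. indicator A (ordered_element (E \<omega>) k))) \<longlonglongrightarrow> \<alpha>"
  proof (rule AE_mp[OF _ AE_mp], intro AE_I2 impI)
    fix \<omega> assume "\<omega> \<in> space M"
      and "(\<lambda>n. (\<Sum>j\<in>E \<omega> \<inter> {1..n}. indicator UNIV j :: real) / H n) \<longlonglongrightarrow> 1"
      and "(\<lambda>n. (\<Sum>j\<in>E \<omega> \<inter> {1..n}. indicator A j :: real) / H n) \<longlonglongrightarrow> \<alpha>"
    then show "(\<lambda>n. 1 / real n * (\<Sum>k=1..n. indicator A (ordered_element (E \<omega>) k))) \<longlonglongrightarrow> \<alpha>"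
      by (intro mean_along_ordered_elements_tendsto[OF positive H_lim]) auto
  qed
  then show ?thesis by (simp add: has_URI_density_def)
qed

end
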